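(* Let $n\geq 2$ and let $f=1^{x_{1}}0^{y_{1}}1^{x_{2}}0^{y_{2}}\cdots 1^{x_{n}}0^{y_{n}}$ with integers $x_i\geq 1$, $y_i\geq 1$ for $i=1,\ldots,n$. If $x_{1}\geq 2$ and $y_{n}\geq 2$, then $Q_{d}(f)\not\hookrightarrow Q_{d}$ for all $d\geq 2\sum_{i=1}^{n}(x_{i}+y_{i})-2$.
   Context: All strings are binary; $1^a$ (resp. $0^a$) denotes the string of $a$ consecutive ones (resp. zeros), and juxtaposition is concatenation. $Q_d$ is the $d$-dimensional hypercube: its vertices are the binary strings of length $d$, two being adjacent iff they differ in exactly one bit. A string $f$ is a factor of $\mu$ if $f$ appears as $|f|$ consecutive bits of $\mu$. The generalized Fibonacci cube $Q_d(f)$ is the subgraph of $Q_d$ induced by all strings of length $d$ that do not contain $f$ as a factor. A subgraph $H$ of a connected graph $G$ is an isometric subgraph, written $H\hookrightarrow G$ (and $H\not\hookrightarrow G$ otherwise), if $d_H(\mu,\nu)=d_G(\mu,\nu)$ for all $\mu,\nu\in V(H)$ (with $d_H=\infty$ for vertices in different components of $H$). *)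

theory Defs
  imports Graph_Theory.Pair_Digraph Graph_Theory.Digraph_Component Graph_Theory.Shortest_Path
    "HOL-Library.Sublist"
begin

text \<open>
  Binary strings are lists of booleans, with \<^const>\<open>True\<close> for 1 and \<^const>\<open>False\<close> for 0; a factor is
  a contiguous sublist, i.e. \<^const>\<open>sublist\<close>. An undirected edge is represented by the two
  opposite arcs between its endpoints.
\<close>

definition hypercube :: "nat \<Rightarrow> (bool list, bool list \<times> bool list) pre_digraph" where
  "hypercube d = with_proj
    \<lparr> pverts = {u. length u = d},
      parcs = {(u, v). length u = d \<and> length v = d \<and> (\<exists>!i. i < d \<and> u ! i \<noteq> v ! i)} \<rparr>"

definition gen_fib_cube :: "nat \<Rightarrow> bool list \<Rightarrow> (bool list, bool list \<times> bool list) pre_digraph" where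
  "gen_fib_cube d f = hypercube d \<restriction> {u \<in> verts (hypercube d). \<not> sublist f u}"

text \<open>
  With unit weights the library's minimal walk cost is the usual graph distance; it is \<open>\<infinity>\<close>
  if there is no walk.
\<close>

definition graph_dist :: "('a, 'b) pre_digraph \<Rightarrow> 'a \<Rightarrow> 'a \<Rightarrow> ereal" where
  "graph_dist G u v = wf_digraph.\<mu> G (\<lambda>_. 1) u v"

definition isometric_subgraph :: "('a, 'b) pre_digraph \<Rightarrow> ('a, 'b) pre_digraph \<Rightarrow> bool"
    (infix \<open>\<hookrightarrow>\<close> 50) where
  "H \<hookrightarrow> G \<longleftrightarrow> subgraph H G \<and>
    (\<forall>u \<in> verts H. \<forall>v \<in> verts H. graph_dist H u v = graph_dist G u v)"

definition block_string :: "nat \<Rightarrow> (nat \<Rightarrow> nat) \<Rightarrow> (nat \<Rightarrow> nat) \<Rightarrow> bool list" where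
  "block_string n x y = concat (map (\<lambda>i. replicate (x i) True @ replicate (y i) False) [1..<Suc n])"

text \<open>
  The hypercube is a simple connected graph and \<^const>\<open>gen_fib_cube\<close> is an induced subgraph of it.
  In particular, \<open>\<not> gen_fib_cube d f \<hookrightarrow> hypercube d\<close> is never due to a failure of the
  \<^const>\<open>subgraph\<close> conjunct: it always means that some distance differs.
\<close>

lemma verts_hypercube [simp]: "verts (hypercube d) = {u. length u = d}"
  by (simp add: hypercube_def)

lemma arcs_ends_hypercube:
  "arcs_ends (hypercube d) =
    {(u, v). length u = d \<and> length v = d \<and> (\<exists>!i. i < d \<and> u ! i \<noteq> v ! i)}"
  by (simp add: hypercube_def)

lemma finite_bool_lists: "finite {u :: bool list. length u = d}"
  using finite_lists_length_eq[of "UNIV :: bool set" d] by simp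

lemma graph_hypercube: "graph (hypercube d)"
proof -
  define E where
    "E = {(u :: bool list, v). length u = d \<and> length v = d \<and> (\<exists>!i. i < d \<and> u ! i \<noteq> v ! i)}"
  let ?P = "\<lparr> pverts = {u :: bool list. length u = d}, parcs = E \<rparr>"
  have sub: "E \<subseteq> {u. length u = d} \<times> {u. length u = d}"
    unfolding E_def by blast
  have fin: "finite E"
    by (rule finite_subset[OF sub finite_cartesian_product[OF finite_bool_lists finite_bool_lists]])
  have comm: "u ! i \<noteq> v ! i \<longleftrightarrow> v ! i \<noteq> u ! i" for u v :: "bool list" and i
    by (rule neq_commute)
  have sym: "sym E"
  proof (rule symI)
    fix u v assume "(u, v) \<in> E"
    then show "(v, u) \<in> E" unfolding E_def mem_Collect_eq case_prod_conv
      by (subst comm) blast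
  qed
  have "(u, u) \<notin> E" for u
    unfolding E_def by (auto elim: ex1E)
  then have irr: "fst e \<noteq> snd e" if "e \<in> E" for e
    using that by (metis prod.collapse)
  have "pair_graph ?P"
  proof
    show "finite (pverts ?P)" using finite_bool_lists[of d] by simp
    show "finite (parcs ?P)" using fin by simp
    show "symmetric (with_proj ?P)" using sym by (simp add: symmetric_def)
    show "fst e \<noteq> snd e" if "e \<in> parcs ?P" for e using irr that by simp
    show "fst e \<in> pverts ?P" if "e \<in> parcs ?P" for e using sub that by auto
    show "snd e \<in> pverts ?P" if "e \<in> parcs ?P" for e using sub that by auto
  qed
  then show ?thesis
    unfolding hypercube_def E_def by (rule pair_graph.pair_graphD_graph)
qed

lemma wf_hypercube: "wf_digraph (hypercube d)"
proof -
  interpret graph "hypercube d" by (rule graph_hypercube)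
  show ?thesis by unfold_locales
qed

lemma induced_subgraph_gen_fib_cube: "induced_subgraph (gen_fib_cube d f) (hypercube d)"
  unfolding gen_fib_cube_def by (rule wf_digraph.induced_induce[OF wf_hypercube]) auto

lemma isometric_gen_fib_cube_iff:
  "gen_fib_cube d f \<hookrightarrow> hypercube d \<longleftrightarrow>
    (\<forall>u \<in> verts (gen_fib_cube d f). \<forall>v \<in> verts (gen_fib_cube d f).
      graph_dist (gen_fib_cube d f) u v = graph_dist (hypercube d) u v)"
  using induced_subgraph_gen_fib_cube by (auto simp: isometric_subgraph_def induced_subgraph_def)

lemma hypercube_reachable:
  assumes "length u = d" "length v = d"
  shows "u \<rightarrow>\<^sup>*\<^bsub>hypercube d\<^esub> v"
  using assms
proof (induction "card {i. i < d \<and> u ! i \<noteq> v ! i}" arbitrary: u)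
  case 0
  then have "{i. i < d \<and> u ! i \<noteq> v ! i} = {}" by simp
  with 0 have "u = v" by (auto intro: nth_equalityI)
  with 0 show ?case by (simp add: wf_digraph.reachable_refl[OF wf_hypercube])
next
  case (Suc k)
  let ?D = "{i. i < d \<and> u ! i \<noteq> v ! i}"
  from Suc.hyps(2) have "?D \<noteq> {}" by (metis card.empty nat.distinct(1))
  then obtain i where i: "i < d" "u ! i \<noteq> v ! i" by auto
  let ?w = "u[i := v ! i]"
  have "{j. j < d \<and> ?w ! j \<noteq> v ! j} = ?D - {i}"
    using i Suc.prems by (auto simp: nth_list_update)
  then have "k = card {j. j < d \<and> ?w ! j \<noteq> v ! j}"
    using Suc.hyps(2) i by simp
  then have "?w \<rightarrow>\<^sup>*\<^bsub>hypercube d\<^esub> v"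
    using Suc.hyps(1)[of ?w] Suc.prems by simp
  moreover have "u \<rightarrow>\<^bsub>hypercube d\<^esub> ?w"
    using i Suc.prems by (auto simp: arcs_ends_hypercube nth_list_update)
  ultimately show ?case
    by (rule wf_digraph.adj_reachable_trans[OF wf_hypercube, rotated])
qed

lemma strongly_connected_hypercube: "strongly_connected (hypercube d)"
proof (rule strongly_connectedI)
  show "verts (hypercube d) \<noteq> {}" by (auto intro: exI[of _ "replicate d True"])
qed (simp add: hypercube_reachable)

end

theory Submission
  imports Defs
begin

text \<open>
  Write \<open>f = p00 = 11s\<close> and consider the four words \<open>p a b s 1\<^sup>m\<close>. Those with \<open>ab = 00\<close> and
  \<open>ab = 11\<close> contain \<open>f\<close>; they are the only common neighbours of those with \<open>ab = 01\<close> and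
  \<open>ab = 10\<close>. If the latter avoid \<open>f\<close>, they are at distance 2 in the hypercube but not in the
  generalized Fibonacci cube. An occurrence of \<open>f\<close> in \<open>pabs\<close> covers \<open>ab\<close>, so it yields
  \<open>f = \<alpha> a b \<beta>\<close> with \<open>p = \<gamma>\<alpha>\<close> and \<open>s = \<beta>\<delta>\<close>, and counting ones in \<open>\<gamma>\<alpha>00 = \<alpha>ab\<beta>\<close> shows that
  \<open>\<gamma>\<close> has exactly one more one than \<open>\<beta>\<close>. If \<open>\<beta>\<close> ends in \<open>00\<close>, then \<open>\<gamma>\<close> is \<open>11\<beta>\<close> without this
  ending, so it has two more ones, a contradiction; if \<open>\<beta> = 0\<close>, then \<open>f = 1\<^sup>k00\<close>.
\<close>

section \<open>Neighbours and distances in the two cubes\<close>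

lemma hypercube_simps:
  "e \<in> arcs (hypercube d) \<longleftrightarrow> length (fst e) = d \<and> length (snd e) = d \<and>
    (\<exists>!i. i < d \<and> fst e ! i \<noteq> snd e ! i)"
  "tail (hypercube d) = fst" "head (hypercube d) = snd"
  by (simp_all add: hypercube_def case_prod_beta)

lemma gen_fib_cube_simps:
  "u \<in> verts (gen_fib_cube d f) \<longleftrightarrow> length u = d \<and> \<not> sublist f u"
  "tail (gen_fib_cube d f) = fst" "head (gen_fib_cube d f) = snd"
  by (simp_all add: gen_fib_cube_def hypercube_simps)

lemma gen_fib_cube_arcD:
  assumes "e \<in> arcs (gen_fib_cube d f)"
  shows "\<exists>!i. i < d \<and> fst e ! i \<noteq> snd e ! i"
proof -
  have "e \<in> arcs (hypercube d)" using assms by (simp add: gen_fib_cube_def)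
  then show ?thesis by (simp only: hypercube_simps)
qed

lemma list_update_differs_once:
  assumes "i < length u" "b \<noteq> u ! i"
  shows "\<exists>!j. j < length u \<and> u ! j \<noteq> u[i := b] ! j"
  using assms by (intro ex1I[of _ i]) (auto simp: nth_list_update split: if_splits)

text \<open>If the middle bits of \<open>w\<close> differed from each other, they would be
  complementary to those of one of the two words, giving two differences from it. Once they agree,
  exactly one of them differs from the first word; this uses up the single allowed difference and
  forces the rest of \<open>w\<close>.\<close>

lemma common_neighbour_cases:
  assumes len: "length w = length p + 2 + length s"
    and w1: "\<exists>!i. i < length w \<and> (p @ [a, \<not> a] @ s) ! i \<noteq> w ! i"
    and w2: "\<exists>!i. i < length w \<and> w ! i \<noteq> (p @ [\<not> a, a] @ s) ! i"
  shows "\<exists>b. w = p @ [b, b] @ s"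
proof -
  let ?l = "length p"
  let ?u = "p @ [a, \<not> a] @ s" and ?v = "p @ [\<not> a, a] @ s"
  have uv: "?u ! ?l = a" "?u ! Suc ?l = (\<not> a)" "?v ! ?l = (\<not> a)" "?v ! Suc ?l = a"
    by (auto simp: nth_append)
  have same: "?u ! j = ?v ! j" if "j \<noteq> ?l" "j \<noteq> Suc ?l" for j
    using that by (auto simp: nth_append nth_Cons split: nat.splits)
  have bnd: "?l < length w" "Suc ?l < length w" using len by auto
  have mid: "w ! ?l = w ! Suc ?l"
  proof (rule ccontr)
    assume "w ! ?l \<noteq> w ! Suc ?l"
    then have "(?u ! ?l \<noteq> w ! ?l \<and> ?u ! Suc ?l \<noteq> w ! Suc ?l) \<or>
      (w ! ?l \<noteq> ?v ! ?l \<and> w ! Suc ?l \<noteq> ?v ! Suc ?l)"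
      unfolding uv by auto
    then show False using w1 w2 bnd by (metis n_not_Suc_n)
  qed
  have rest: "w ! j = ?u ! j" if "j \<noteq> ?l" "j \<noteq> Suc ?l" "j < length w" for j
  proof (rule ccontr)
    assume ne: "w ! j \<noteq> ?u ! j"
    have "?u ! ?l \<noteq> w ! ?l \<or> ?u ! Suc ?l \<noteq> w ! Suc ?l"
      using mid unfolding uv by auto
    then show False using w1 bnd ne that by metis
  qed
  have "w = p @ [w ! ?l, w ! ?l] @ s"
  proof (rule nth_equalityI)
    fix j assume j: "j < length w"
    show "w ! j = (p @ [w ! ?l, w ! ?l] @ s) ! j"
    proof (cases "j = ?l \<or> j = Suc ?l")
      case True
      then show ?thesis using mid by (auto simp: nth_append)
    next
      case False
      then show ?thesis using rest[of j] j
        by (auto simp: nth_append nth_Cons split: nat.splits)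
    qed
  qed (use len in simp)
  then show ?thesis by blast
qed

lemma not_isometric_if_square:
  assumes "\<not> sublist f (p @ [True, False] @ s)" "\<not> sublist f (p @ [False, True] @ s)"
    and "sublist f (p @ [True, True] @ s)" "sublist f (p @ [False, False] @ s)"
  shows "\<not> gen_fib_cube (length p + 2 + length s) f \<hookrightarrow> hypercube (length p + 2 + length s)"
proof
  define d where "d = length p + 2 + length s"
  let ?H = "gen_fib_cube d f" and ?Q = "hypercube d"
  let ?u = "p @ [True, False] @ s" and ?v = "p @ [False, True] @ s"
    and ?w = "p @ [True, True] @ s"
  assume "gen_fib_cube (length p + 2 + length s) f \<hookrightarrow> hypercube (length p + 2 + length s)"
  then have eq: "graph_dist ?H ?u ?v = graph_dist ?Q ?u ?v"
    unfolding isometric_gen_fib_cube_iff d_def using assms by (auto simp: gen_fib_cube_simps)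
  interpret Q: wf_digraph ?Q by (rule wf_hypercube)
  interpret H: wf_digraph ?H
    using induced_subgraph_gen_fib_cube by (auto simp: induced_subgraph_def subgraph_def)
  \<comment> \<open>An upper bound on the hypercube distance suffices: this walk turns the second
    middle bit to 1 and then the first to 0.\<close>
  have arcs: "(?u, ?w) \<in> arcs ?Q" "(?w, ?v) \<in> arcs ?Q"
    using list_update_differs_once[of "Suc (length p)" ?u True]
      list_update_differs_once[of "length p" ?w False]
    by (simp_all add: hypercube_simps d_def nth_append list_update_append)
  have "?v \<in> verts ?Q" by (simp add: d_def)
  then have "Q.awalk ?u [(?u, ?w), (?w, ?v)] ?v"
    unfolding Q.awalk_Cons_iff Q.awalk_Nil_iff hypercube_simps(2,3) using arcs by simp
  then have "graph_dist ?Q ?u ?v \<le> ereal (Q.awalk_cost (\<lambda>_. 1) [(?u, ?w), (?w, ?v)])"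
    unfolding graph_dist_def by (rule Q.min_cost_le_walk_cost)
  also have "\<dots> = 2" by simp
  finally have le: "graph_dist ?Q ?u ?v \<le> 2" .
  \<comment> \<open>Shorter walks fail for three reasons: the endpoints differ, they differ in two
    bits, and a midpoint would be one of the two words containing \<open>f\<close>.\<close>
  have "3 \<le> length es" if walk: "H.awalk ?u es ?v" for es
  proof (rule ccontr)
    assume "\<not> 3 \<le> length es"
    then consider "es = []" | e where "es = [e]" | e e' where "es = [e, e']"
      by (cases es; cases "tl es"; cases "tl (tl es)") auto
    then show False
    proof cases
      case 1
      then show False using walk by (auto simp: H.awalk_Nil_iff)
    next
      case (2 e)
      then have "e \<in> arcs ?H" "fst e = ?u" "snd e = ?v"
        using walk by (auto simp: H.awalk_Cons_iff H.awalk_Nil_iff gen_fib_cube_simps)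
      then have "\<exists>!i. i < d \<and> ?u ! i \<noteq> ?v ! i"
        using gen_fib_cube_arcD by metis
      moreover have "?u ! length p \<noteq> ?v ! length p" "?u ! Suc (length p) \<noteq> ?v ! Suc (length p)"
        by (auto simp: nth_append)
      moreover have "length p < d" "Suc (length p) < d" by (auto simp: d_def)
      ultimately show False by (metis n_not_Suc_n)
    next
      case (3 e e')
      define z where "z = snd e"
      from 3 have e: "e \<in> arcs ?H" "fst e = ?u" "e' \<in> arcs ?H" "fst e' = z" "snd e' = ?v"
        using walk by (auto simp: z_def H.awalk_Cons_iff H.awalk_Nil_iff gen_fib_cube_simps)
      have "z \<in> verts ?H" using H.head_in_verts[OF e(1)] by (simp add: z_def gen_fib_cube_simps)
      then have z: "length z = d" "\<not> sublist f z" by (auto simp: gen_fib_cube_simps)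
      have "\<exists>!i. i < d \<and> ?u ! i \<noteq> z ! i" "\<exists>!i. i < d \<and> z ! i \<noteq> ?v ! i"
        using gen_fib_cube_arcD[OF e(1)] gen_fib_cube_arcD[OF e(3)] e
        unfolding z_def by simp_all
      then have "\<exists>b. z = p @ [b, b] @ s"
        using common_neighbour_cases[of z p s True] z(1) by (simp add: d_def)
      then obtain b where "z = p @ [b, b] @ s" by blast
      then show False using assms z(2) by (cases b) auto
    qed
  qed
  \<comment> \<open>The distance is an infimum over walks, so the bound also covers the case of no
    walk, where it is infinite.\<close>
  then have "3 \<le> graph_dist ?H ?u ?v"
    unfolding graph_dist_def H.\<mu>_def
    by (intro INF_greatest) (force simp: H.awalk_cost_def sum_list_triv)
  with le eq have "(3 :: ereal) \<le> 2" by (metis order_trans)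
  then show False by simp
qed

section \<open>Occurrences of \<open>f\<close> in padded and overlapping words\<close>

lemma sublist_append_replicate_iff:
  assumes "f \<noteq> []" "last f \<noteq> c"
  shows "sublist f (w @ replicate m c) \<longleftrightarrow> sublist f w"
proof (induction m)
  case (Suc m)
  \<comment> \<open>The new last letter is not \<open>last f\<close>, so no occurrence of
    \<open>f\<close> ends there.\<close>
  have "\<not> suffix f ((w @ replicate m c) @ [c])"
    using assms by (metis snoc_eq_iff_butlast suffix_snoc)
  then have "sublist f ((w @ replicate m c) @ [c]) \<longleftrightarrow> sublist f (w @ replicate m c)"
    by (simp only: sublist_snoc simp_thms)
  then show ?case using Suc
    by (simp add: replicate_append_same)
qed simp

lemma Cons_eq_snoc_imp_replicate:
  assumes "c # xs = xs @ [c]"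
  shows "xs = replicate (length xs) c"
  using assms by (induction xs) auto

text \<open>The assumption \<open>rise\<close> excludes words such as \<open>f = 1100\<close>, which
  does occur in \<open>p10s = 111000\<close>.\<close>

lemma not_sublist_overlap:
  assumes fp: "f = p @ [False, False]" and fs: "f = [True, True] @ s"
    and rise: "sublist [False, True] f" and ab: "a \<noteq> b"
  shows "\<not> sublist f (p @ [a, b] @ s)"
proof
  assume "sublist f (p @ [a, b] @ s)"
  then obtain g v where w: "p @ [a, b] @ s = g @ f @ v"
    by (auto simp: sublist_def)
  have lens: "length f = length p + 2" "length f = length s + 2"
    using fp fs by (metis length_append length_Cons list.size(3) numeral_2_eq_2,
        metis length_append length_Cons list.size(3) numeral_2_eq_2 add.commute)
  \<comment> \<open>Since \<open>p\<close> and \<open>s\<close> are two letters shorter than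
    \<open>f\<close>, the lengths of \<open>g\<close> and \<open>v\<close> add up to that of
    \<open>p\<close> and of \<open>s\<close>. So \<open>g\<close> ends within \<open>p\<close>,
    \<open>v\<close> starts within \<open>s\<close>, and the occurrence covers
    \<open>ab\<close>.\<close>
  have tot: "length p + 2 + length s = length g + length f + length v"
    using arg_cong[OF w, of length] by simp
  define \<alpha> where "\<alpha> = drop (length g) p"
  define \<beta> where "\<beta> = take (length s - length v) s"
  have p: "p = g @ \<alpha>"
  proof -
    have "take (length g) (p @ [a, b] @ s) = g" using w by simp
    then have "take (length g) p = g" using tot lens by simp
    then show ?thesis unfolding \<alpha>_def by (metis append_take_drop_id)
  qed
  have s: "s = \<beta> @ v"
  proof -
    have "drop (length g + length f) (p @ [a, b] @ s) = v" using w by simp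
    moreover have "length g + length f = length p + 2 + (length s - length v)"
      using tot lens by simp
    ultimately have "drop (length s - length v) s = v" by simp
    then show ?thesis unfolding \<beta>_def by (metis append_take_drop_id)
  qed
  have f: "f = \<alpha> @ [a, b] @ \<beta>" using w p s by simp
  have len: "length g = length \<beta>" using f lens p by simp
  have "count_list f True = count_list g True + count_list \<alpha> True"
    using fp p by simp
  moreover have "count_list f True = count_list \<alpha> True + 1 + count_list \<beta> True"
    using f ab by (cases a; cases b) auto
  ultimately have cnt: "count_list g True = Suc (count_list \<beta> True)" by simp
  have "\<beta> \<noteq> []" using cnt len by auto
  then consider c where "\<beta> = [c]" | \<beta>' c c' where "\<beta> = \<beta>' @ [c', c]"
    by (metis append.assoc append_Cons append_Nil rev_exhaust)
  then show False
  proof cases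
    case (1 c)
    then obtain h where h: "g = [h]" using len by (cases g) auto
    have gT: "g = [True]" using fp fs p h by simp
    have "True # \<alpha> @ [False, False] = \<alpha> @ [a, b, c]"
      using fp p gT f 1 by simp
    \<comment> \<open>Comparing the last two letters gives \<open>b = False\<close>, hence
      \<open>a = True\<close>; then prepending a one to \<open>\<alpha>\<close> is the same as
      appending it, so \<open>\<alpha>\<close> is all ones.\<close>
    then have "(True # \<alpha>) @ [False, False] = (\<alpha> @ [a]) @ [b, c]" by simp
    then have "True # \<alpha> = \<alpha> @ [a]" "b = False" by (subst (asm) append_eq_append_conv; simp)+
    then have "True # \<alpha> = \<alpha> @ [True]" using ab by simp
    then have "\<alpha> = replicate (length \<alpha>) True" by (rule Cons_eq_snoc_imp_replicate)
    then have "f = replicate (Suc (length \<alpha>)) True @ replicate 2 False"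
      using fp p gT by (simp add: numeral_2_eq_2)
    \<comment> \<open>The word \<open>f\<close> is now nonincreasing, whereas its factor
      \<open>01\<close> is an increase.\<close>
    moreover have "sorted_wrt (\<ge>) (replicate m b)" for m and b :: bool
      by (simp add: sorted_wrt_iff_nth_less)
    ultimately have "sorted_wrt (\<ge>) f" by (simp add: sorted_wrt_append del: replicate.simps)
    with rise show False by (auto simp: sublist_def sorted_wrt_append)
  next
    case (2 \<beta>' c c')
    have "(\<alpha> @ [a, b] @ \<beta>') @ [c', c] = p @ [False, False]" using f 2 fp by simp
    then have c: "c' = False" "c = False" by (subst (asm) append_eq_append_conv; simp)+
    \<comment> \<open>Both sides are \<open>f\<close>, with \<open>g\<close> and
      \<open>11\<beta>'\<close> as prefixes of equal length; and \<open>\<beta>\<close> has no ones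
      besides those of \<open>\<beta>'\<close>.\<close>
    have "g @ \<alpha> @ [False, False] = ([True, True] @ \<beta>') @ [c', c] @ v"
      using fp p fs s 2 by simp
    moreover have "length g = length ([True, True] @ \<beta>')" using len 2 by simp
    ultimately have "g = [True, True] @ \<beta>'" by (metis append_eq_append_conv)
    then show False using cnt 2 c by simp
  qed
qed

section \<open>Block strings and the choice of the four words\<close>

lemma length_block_string: "length (block_string n x y) = (\<Sum>i = 1..n. x i + y i)"
  unfolding block_string_def
  by (induction n) (auto simp del: upt_Suc simp: upt_Suc_append)

lemma block_string_Suc:
  "block_string (Suc n) x y =
    block_string n x y @ replicate (x (Suc n)) True @ replicate (y (Suc n)) False"
  by (simp add: block_string_def)

lemma block_string_prefix:
  assumes "n \<ge> m"
  shows "\<exists>r. block_string n x y = block_string m x y @ r"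
  using assms by (induction n rule: dec_induct) (auto simp: block_string_Suc)

theorem lemma2p1:
  fixes n :: nat and x y :: "nat \<Rightarrow> nat" and f :: "bool list"
  assumes "n \<ge> 2"
    and "\<And>i. i \<in> {1..n} \<Longrightarrow> x i \<ge> 1"
    and "\<And>i. i \<in> {1..n} \<Longrightarrow> y i \<ge> 1"
    and "f = block_string n x y"
    and "x 1 \<ge> 2" and "y n \<ge> 2"
  shows "\<forall>d \<ge> 2 * (\<Sum>i = 1..n. x i + y i) - 2. \<not> gen_fib_cube d f \<hookrightarrow> hypercube d"
proof (intro allI impI)
  fix d assume d: "d \<ge> 2 * (\<Sum>i = 1..n. x i + y i) - 2"
  obtain r where r: "f = block_string 2 x y @ r"
    using block_string_prefix[OF assms(1)] assms(4) by blast
  obtain x1 where x1: "x 1 = Suc (Suc x1)"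
    using assms(5) by (metis add_2_eq_Suc le_Suc_ex)
  obtain yn where yn: "y n = Suc (Suc yn)"
    using assms(6) by (metis add_2_eq_Suc le_Suc_ex)
  obtain y1 where y1: "y 1 = Suc y1" using assms(1) assms(3)[of 1] by (auto dest!: Suc_le_D)
  obtain x2 where x2: "x 2 = Suc x2" using assms(1) assms(2)[of 2] by (auto dest!: Suc_le_D)
  have f12: "f = replicate (x 1) True @ replicate (y 1) False @
      replicate (x 2) True @ replicate (y 2) False @ r"
    using r by (simp add: block_string_def numeral_2_eq_2)
  obtain s where s: "f = [True, True] @ s" using f12 x1 by simp
  \<comment> \<open>The factor \<open>01\<close> sits at the boundary between the first two
    blocks.\<close>
  have "f = (replicate (x 1) True @ replicate y1 False) @ [False, True] @
      (replicate x2 True @ replicate (y 2) False @ r)"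
    using f12 y1 x2 by (simp add: replicate_app_Cons_same)
  then have rise: "sublist [False, True] f" by (metis sublist_appendI)
  obtain n' where "n = Suc n'" using assms(1) by (cases n) auto
  then have "f = (block_string n' x y @ replicate (x n) True @ replicate yn False) @ [False, False]"
    using assms(4) yn by (simp add: block_string_Suc replicate_app_Cons_same)
  then obtain p where p: "f = p @ [False, False]" by blast
  have L: "length f = (\<Sum>i = 1..n. x i + y i)" using assms(4) length_block_string by simp
  \<comment> \<open>The unpadded words have length \<open>2 * length f - 2\<close>, so the bound on
    \<open>d\<close> keeps the subtraction from truncating. The padding consists of ones because
    \<open>f\<close> ends in a zero.\<close>
  define t where "t = s @ replicate (d - (2 * length f - 2)) True"
  have len: "d = length p + 2 + length t"
    using d p arg_cong[OF s, of length] unfolding L[symmetric] t_def by simp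
  have avoid: "\<not> sublist f (p @ [a, b] @ t)" if "a \<noteq> b" for a b
    using not_sublist_overlap[OF p s rise that]
      sublist_append_replicate_iff[of f True "p @ [a, b] @ s"] p
    by (simp add: t_def)
  have "p @ [True, True] @ t = p @ f @ replicate (d - (2 * length f - 2)) True"
    using s by (simp add: t_def)
  then have "sublist f (p @ [True, True] @ t)" by (metis sublist_appendI)
  moreover have "p @ [False, False] @ t = [] @ f @ t" using p by simp
  then have "sublist f (p @ [False, False] @ t)" by (metis sublist_appendI)
  ultimately show "\<not> gen_fib_cube d f \<hookrightarrow> hypercube d"
    using not_isometric_if_square[of f p t] avoid unfolding len[symmetric] by blast
qed

end
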